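(* Let $\mathcal{D}=\{0,1,2\}$. The set of real numbers of the form \[ \tfrac{1}{2}\sum_{i=0}^{k}d_i\left(-\tfrac32\right)^i \qquad (k\in\mathbb{N},\; d_i\in\mathcal{D}) \] is equal to $\mathbb{Z}[\tfrac12]=\{a2^{-\ell}\mid a\in\mathbb{Z},\ \ell\in\mathbb{N}\}$.
   Context: $\mathbb{N}$ denotes the set of nonnegative integers. *)

theory Defs
  imports Complex_Main
begin

definition digits :: "nat set" where
  "digits = {0, 1, 2}"

definition dyadic_rationals :: "real set" where
  "dyadic_rationals = {of_int a / 2 ^ l | (a :: int) (l :: nat). True}"

end

theory Submission
  imports Defs
begin

text \<open>
  For dyadic \<open>x\<close> choose the digit \<open>d\<close> with \<open>d \<equiv> 2x\<close> modulo 3 and put \<open>y = (d - 2x) / 3\<close>, so that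
  \<open>x = d/2 + (-3/2) y\<close>. If \<open>x = a / 2^(l+1)\<close> then \<open>y\<close> has denominator \<open>2^l\<close>, so after finitely many
  steps one reaches an integer. On nonzero integers the step \<open>x \<mapsto> y\<close> decreases \<open>2\<bar>x\<bar> + [x < 0]\<close>;
  the bracket is needed because of the orbit \<open>-2 \<mapsto> 2 \<mapsto> -1 \<mapsto> 1 \<mapsto> 0\<close>.
\<close>

definition expansions :: "real set" where
  "expansions = {(1 / 2) * (\<Sum>i = 0..k. real (d i) * (- (3 / 2)) ^ i) | (k :: nat) (d :: nat \<Rightarrow> nat).
            \<forall>i \<in> {0..k}. d i \<in> digits}"

lemma zero_in_expansions: "0 \<in> expansions"
  unfolding expansions_def digits_def
  by (auto intro!: exI[of _ 0] exI[of _ "\<lambda>_. 0"])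

text \<open>Horner's rule: prepending the digit \<open>c\<close> shifts every old exponent up by
  one. This inverts the step \<open>x \<mapsto> y\<close>.\<close>

lemma expansions_step:
  assumes "y \<in> expansions" and "c \<in> digits"
  shows "real c / 2 - 3 / 2 * y \<in> expansions"
proof -
  obtain k d where y: "y = (1 / 2) * (\<Sum>i = 0..k. real (d i) * (- (3 / 2)) ^ i)"
    and d: "\<forall>i \<in> {0..k}. d i \<in> digits"
    using assms(1) unfolding expansions_def by blast
  define e where "e = case_nat c d"
  have "(\<Sum>i = 0..Suc k. real (e i) * (- (3 / 2)) ^ i)
      = real c + (\<Sum>i = 0..k. real (d i) * (- (3 / 2)) ^ Suc i)"
    by (simp add: sum.atLeast0_atMost_Suc_shift e_def del: sum.atLeast0_atMost_Suc sum.cl_ivl_Suc power_Suc)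
  also have "(\<Sum>i = 0..k. real (d i) * (- (3 / 2)) ^ Suc i)
      = - (3 / 2) * (\<Sum>i = 0..k. real (d i) * (- (3 / 2)) ^ i)"
    unfolding sum_distrib_left by (intro sum.cong) simp_all
  finally have "real c / 2 - 3 / 2 * y
      = (1 / 2) * (\<Sum>i = 0..Suc k. real (e i) * (- (3 / 2)) ^ i)"
    unfolding y by (simp add: algebra_simps)
  moreover have "\<forall>i \<in> {0..Suc k}. e i \<in> digits"
    using d assms(2) by (auto simp: e_def split: nat.split)
  ultimately show ?thesis
    unfolding expansions_def by blast
qed

lemma int_in_expansions: "real_of_int n \<in> expansions"
proof (induction "nat (if n < 0 then 2 * \<bar>n\<bar> + 1 else 2 * \<bar>n\<bar>)" arbitrary: n rule: less_induct)
  case less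
  define c where "c = (2 * n) mod 3"
  define m where "m = (c - 2 * n) div 3"
  have c: "0 \<le> c" "c < 3" by (simp_all add: c_def)
  have "3 dvd c - 2 * n" unfolding c_def by presburger
  then have m: "3 * m = c - 2 * n" by (simp add: m_def)
  have eq: "real_of_int n = real (nat c) / 2 - 3 / 2 * real_of_int m"
    using arg_cong[OF m, of real_of_int] c by (simp add: field_simps)
  have dig: "nat c \<in> digits"
    using c unfolding digits_def by auto
  show ?case
  proof (cases "n = 0")
    case False
    \<comment> \<open>If \<open>n > 0\<close> then \<open>-n < m \<le> 0\<close>; if
      \<open>n < 0\<close> then \<open>0 < m \<le> -n\<close>. Equality occurs at
      \<open>n = -1\<close> and \<open>n = -2\<close>, where only the extra 1 for negative integers
      makes the measure drop.\<close>
    have "real_of_int m \<in> expansions"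
      using False m c by (intro less; simp split: if_splits; presburger)
    then show ?thesis unfolding eq using dig by (rule expansions_step)
  qed (simp add: zero_in_expansions)
qed

lemma dyadic_in_expansions: "real_of_int a / 2 ^ l \<in> expansions"
proof (induction l arbitrary: a)
  case 0
  show ?case using int_in_expansions by simp
next
  case (Suc l)
  \<comment> \<open>\<open>2 ^ l\<close> is its own inverse modulo 3.\<close>
  define c where "c = (2 ^ l * a) mod 3"
  have c: "0 \<le> c" "c < 3" by (simp_all add: c_def)
  \<comment> \<open>Modulo 3, \<open>c * 2 ^ l\<close> is \<open>4 ^ l * a\<close>, and 4 is 1, so
    \<open>c * 2 ^ l - a\<close> is divisible by 3.\<close>
  have "(3 :: int) dvd 4 ^ l - 1"
    using power_diff_1_eq[of "4 :: int" l] by simp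
  have "(c * 2 ^ l - a) mod 3 = (2 ^ l * a * 2 ^ l - a) mod 3"
    unfolding c_def by (metis mod_diff_left_eq mod_mult_left_eq)
  also have "2 ^ l * a * 2 ^ l - a = (4 ^ l - 1) * a"
    by (simp add: algebra_simps flip: power_mult_distrib)
  also have "\<dots> mod 3 = 0"
    using \<open>3 dvd 4 ^ l - 1\<close> by auto
  finally obtain b where b: "c * 2 ^ l - a = 3 * b"
    by (auto simp: mod_eq_0_iff_dvd)
  have "real_of_int c * 2 ^ l - real_of_int a = 3 * real_of_int b"
    using arg_cong[OF b, of real_of_int] by simp
  \<comment> \<open>The new value \<open>b / 2 ^ l\<close> has one factor 2 fewer in its
    denominator, so the induction hypothesis covers it.\<close>
  then have "real_of_int a / 2 ^ Suc l = real (nat c) / 2 - 3 / 2 * (real_of_int b / 2 ^ l)"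
    using c by (simp add: field_simps)
  moreover have "nat c \<in> digits"
    using c unfolding digits_def by auto
  ultimately show ?case
    using expansions_step[OF Suc.IH] by metis
qed

text \<open>The denominator \<open>2 ^ i\<close> of each term divides \<open>2 ^ k\<close>.\<close>

lemma expansion_sum_dyadic:
  "\<exists>a :: int. (\<Sum>i = 0..k. real (d i) * (- (3 / 2)) ^ i) = of_int a / 2 ^ k"
proof (induction k)
  case 0
  show ?case by (auto intro: exI[of _ "int (d 0)"])
next
  case (Suc k)
  then obtain a :: int where "(\<Sum>i = 0..k. real (d i) * (- (3 / 2)) ^ i) = of_int a / 2 ^ k" by blast
  \<comment> \<open>Over the denominator \<open>2 ^ Suc k\<close> the old numerator doubles and the
    new term contributes its digit times \<open>(-3) ^ Suc k\<close>.\<close>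
  then have "(\<Sum>i = 0..Suc k. real (d i) * (- (3 / 2)) ^ i)
      = of_int (2 * a + int (d (Suc k)) * (-3) ^ Suc k) / 2 ^ Suc k"
    using power_divide[of "-3 :: real" 2 "Suc k"]
    by (simp add: add_divide_distrib del: power_Suc) simp
  then show ?case by blast
qed

lemma expansions_subset_dyadic: "expansions \<subseteq> dyadic_rationals"
proof
  fix x assume "x \<in> expansions"
  then obtain k d where "x = (1 / 2) * (\<Sum>i = 0..k. real (d i) * (- (3 / 2)) ^ i)"
    unfolding expansions_def by blast
  moreover obtain a :: int where "(\<Sum>i = 0..k. real (d i) * (- (3 / 2)) ^ i) = of_int a / 2 ^ k"
    using expansion_sum_dyadic by blast
  ultimately have "x = of_int a / 2 ^ Suc k" by simp
  then show "x \<in> dyadic_rationals" unfolding dyadic_rationals_def by blast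
qed

theorem theorem2:
  shows "{(1 / 2) * (\<Sum>i = 0..k. real (d i) * (- (3 / 2)) ^ i) | (k :: nat) (d :: nat \<Rightarrow> nat).
            \<forall>i \<in> {0..k}. d i \<in> digits} = dyadic_rationals"
  using expansions_subset_dyadic dyadic_in_expansions
  unfolding expansions_def[symmetric] dyadic_rationals_def by blast

end
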